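(* Let $u,v\in\mathcal{S}_n$ and $s=u^{-1}$, $t=v^{-1}$. Then $u\sim_{ss}v$ if and only if \[ \Big|\,\overline{s_i}\cap\Big(\bigcup_{j=i+1}^{n}\overline{s_j}\Big)\Big|=\Big|\,\overline{t_i}\cap\Big(\bigcup_{j=i+1}^{n}\overline{t_j}\Big)\Big| \] for each $i\in[n-1]$ and every embedding set $E$.
   Context: $[m]=\{1,\ldots,m\}$. $\mathbb{P}$ is the set of positive integers and $\mathbb{P}^*$ the set of finite words over $\mathbb{P}$. For $w=w_1\cdots w_n\in\mathbb{P}^*$, $|w|=n$ is its length and $\|w\|=w_1+\cdots+w_n$ its height. For words $u,w$, an index $j\ge 1$ is an embedding index of $u$ into $w$ if $j+|u|-1\le|w|$ and $u_i\le w_{j+i-1}$ for all $1\le i\le|u|$; $Em(u,w)$ denotes the set of all embedding indices of $u$ into $w$. A bijection $f:\mathbb{P}^*\to\mathbb{P}^*$ is weight-preserving if $|f(w)|=|w|$ and $\|f(w)\|=\|w\|$ for all $w$. Two words $u,v$ are super-strongly Wilf equivalent, written $u\sim_{ss}v$, if there is a weight-preserving bijection $f:\mathbb{P}^*\to\mathbb{P}^*$ with $Em(u,w)=Em(v,f(w))$ for all $w\in\mathbb{P}^*$. $\mathcal{S}_n$ is the set of permutations of $[n]$, viewed as words of length $n$ in which each letter of $[n]$ occurs exactly once; for $u\in\mathcal{S}_n$, the inverse $s=u^{-1}=s_1s_2\cdots s_n$ has $s_i$ equal to the position of the letter $i$ in $u$. An embedding set is a set $E=\{1,\,1+e_1,\ldots,1+e_1+\cdots+e_r\}$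 with $r\ge 0$ and positive integers $e_1,\ldots,e_r$. For fixed $E$ and $j\in[n]$, $\overline{j}=(j-1)+E=\{j,\,j+e_1,\ldots,j+e_1+\cdots+e_r\}$ is the shift of $E$ by $j-1$. *)

theory Defs
  imports "HOL-Combinatorics.Multiset_Permutations"
begin

definition words :: "nat list set" where
  "words = lists {1..}"

text \<open>Letters are numbered from 1, list positions from 0.\<close>

definition letter :: "'a list \<Rightarrow> nat \<Rightarrow> 'a" where
  "letter w i = w ! (i - 1)"

definition height :: "nat list \<Rightarrow> nat" where
  "height w = sum_list w"

definition embedding_index :: "nat list \<Rightarrow> nat list \<Rightarrow> nat \<Rightarrow> bool" where
  "embedding_index u w j \<longleftrightarrow>
     1 \<le> j \<and> j + length u - 1 \<le> length w \<and>
     (\<forall>i\<in>{1..length u}. letter u i \<le> letter w (j + i - 1))"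

definition Em :: "nat list \<Rightarrow> nat list \<Rightarrow> nat set" where
  "Em u w = {j. embedding_index u w j}"

definition weight_preserving :: "(nat list \<Rightarrow> nat list) \<Rightarrow> bool" where
  "weight_preserving f \<longleftrightarrow>
     (\<forall>w\<in>words. length (f w) = length w \<and> height (f w) = height w)"

definition super_strongly_Wilf_equivalent :: "nat list \<Rightarrow> nat list \<Rightarrow> bool"
    (infix "\<sim>ss" 50) where
  "u \<sim>ss v \<longleftrightarrow>
     (\<exists>f. bij_betw f words words \<and> weight_preserving f \<and>
          (\<forall>w\<in>words. Em u w = Em v (f w)))"

text \<open>Elements of \<open>permutations_of_set {1..n}\<close> are the permutations of \<open>{1..n}\<close> written as words.
  The definition of the inverse is meant for such words only, where positions are unique.\<close>

definition position :: "nat list \<Rightarrow> nat \<Rightarrow> nat" where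
  "position u i = (THE p. p \<in> {1..length u} \<and> letter u p = i)"

definition inverse_word :: "nat list \<Rightarrow> nat list" where
  "inverse_word u = map (position u) [1..<Suc (length u)]"

definition embedding_set :: "nat set \<Rightarrow> bool" where
  "embedding_set E \<longleftrightarrow>
     (\<exists>(r::nat) (e :: nat \<Rightarrow> nat). (\<forall>k\<in>{1..r}. 0 < e k) \<and>
        E = {1 + (\<Sum>k=1..m. e k) |m. m \<le> r})"

text \<open>Only used for \<open>j \<ge> 1\<close>, so that the subtraction is not truncated.\<close>

definition shift :: "nat set \<Rightarrow> nat \<Rightarrow> nat set" where
  "shift E j = (\<lambda>x. (j - 1) + x) ` E"

end

theory Submission
  imports Defs
begin

text \<open>
  Write \<open>T\<^sub>k(u)\<close> for the set of positions of \<open>u\<close> that carry a letter \<open>\<ge> k\<close> (\<open>superlevel u k\<close>); for a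
  permutation these are the last \<open>n + 1 - k\<close> entries of \<open>u\<close>'s inverse. Write \<open>S + A\<close> for the union
  of the shifts of \<open>S\<close> by \<open>a - 1\<close>, \<open>a \<in> A\<close> (\<open>shifts S A\<close>).

  Among the words of length \<open>L\<close> whose embedding indices include a given set \<open>S\<close> there is a least one
  in the letterwise order, and the others are exactly the words above it. Hence how many of them have
  a given height depends only on the height of the least one. By Moebius inversion over \<open>S\<close>, the words
  \<open>u\<close> and \<open>v\<close> are super-strongly Wilf equivalent iff these least heights agree for all \<open>S\<close>
  (\<open>super_strongly_Wilf_equivalent_iff_height_minimal_word\<close>). The least word has a letter
  \<open>\<ge> k\<close>, where \<open>k \<ge> 2\<close>, exactly at the positions in \<open>S + T\<^sub>k(u)\<close>, so counting level by level its height is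
  \<open>L + (\<Sum>k=2..n. |S + T\<^sub>k(u)|)\<close> (\<open>height_minimal_word\<close>).

  The overlap numbers of the proposition are the increments of these cardinalities:
  \<open>|E + T\<^sub>i(u)|\<close> plus the \<open>i\<close>-th overlap is \<open>|E| + |E + T\<^bsub>i+1\<^esub>(u)|\<close> (\<open>card_shifts_superlevel_Suc\<close>). So
  equal overlaps mean that \<open>|E + T\<^sub>k(u)| = |E + T\<^sub>k(v)|\<close> for each \<open>k\<close>, which certainly makes the sums over
  \<open>k\<close> equal.

  The converse has to separate the summands, when only the sum over \<open>k\<close> is known for every \<open>E\<close>.
  It turns out that then each \<open>T\<^sub>k(v)\<close> is a translate of \<open>T\<^sub>k(u)\<close>
  (\<open>translates_if_sum_card_shifts_eq\<close>). Punching the reflection of a set \<open>F\<close> out of a long interval \<open>E\<close>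
  lowers \<open>|E + A|\<close> by exactly the number of translates of \<open>A\<close> contained in \<open>F\<close>, so the
  sums determine, for every \<open>F\<close>, the total number of translates of the sets \<open>T\<^sub>k\<close> inside \<open>F\<close>. Taking
  \<open>F = T\<^sub>k(u)\<close>, larger sets contribute nothing, smaller ones contribute equally by induction, and \<open>T\<^sub>k(u)\<close>
  itself contributes; so \<open>T\<^sub>k(v)\<close>, of the same size, must fit into \<open>F\<close> as well.
\<close>

section \<open>Unions of shifts determine a family of sets up to translation\<close>

definition shifts :: "nat set \<Rightarrow> nat set \<Rightarrow> nat set" where
  "shifts E A = (\<Union>a\<in>A. shift E a)"

text \<open>Moving both sets to the right expresses equality up to an integer translation within the
  natural numbers.\<close>

definition translates :: "nat set \<Rightarrow> nat set \<Rightarrow> bool" where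
  "translates A B \<longleftrightarrow> (\<exists>c d. (+) c ` A = (+) d ` B)"

text \<open>These are the translations that carry \<open>A\<close> into \<open>F\<close>. For \<open>A, F \<subseteq> {1..n}\<close> the displacement
  \<open>2 * n - p\<close> may be negative; the offset \<open>2 * n\<close> keeps \<open>p\<close> a natural number and makes it the very
  point that is lost in the lemma \<open>card_shifts_interval_split\<close>.\<close>

definition placements :: "nat \<Rightarrow> nat set \<Rightarrow> nat set \<Rightarrow> nat set" where
  "placements n A F = {p. \<forall>a\<in>A. \<exists>f\<in>F. p + f = a + 2 * n}"

lemma mem_shifts: "x \<in> shifts E A \<longleftrightarrow> (\<exists>a\<in>A. \<exists>y\<in>E. x = a - 1 + y)"
  by (auto simp: shifts_def shift_def)

lemma shifts_mono: "E \<subseteq> E' \<Longrightarrow> shifts E A \<subseteq> shifts E' A"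
  by (auto simp: shifts_def shift_def)

lemma finite_shift [simp]: "finite E \<Longrightarrow> finite (shift E a)"
  by (simp add: shift_def)

lemma card_shift [simp]: "card (shift E a) = card E"
  unfolding shift_def by (intro card_image) (simp add: inj_on_def)

lemma finite_shifts: "finite E \<Longrightarrow> finite A \<Longrightarrow> finite (shifts E A)"
  by (simp add: shifts_def)

lemma shifts_translate:
  assumes "A \<subseteq> {1..}"
  shows "(+) c ` shifts E A = shifts E ((+) c ` A)"
proof -
  have "c + (a - 1 + y) = c + a - 1 + y" if "a \<in> A" for a y
    using assms that by auto
  then show ?thesis
    by (force simp: mem_shifts image_iff)
qed

lemma card_shifts_translates:
  assumes "translates A B" and "A \<subseteq> {1..}" and "B \<subseteq> {1..}"
  shows "card (shifts E A) = card (shifts E B)"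
proof -
  obtain c d where cd: "(+) c ` A = (+) d ` B"
    using assms(1) by (auto simp: translates_def)
  have "card (shifts E A) = card ((+) c ` shifts E A)"
    by (simp add: card_image)
  also have "\<dots> = card ((+) d ` shifts E B)"
    using assms cd by (simp add: shifts_translate)
  also have "\<dots> = card (shifts E B)"
    by (simp add: card_image)
  finally show ?thesis .
qed

lemma card_shifts_shift:
  assumes "A \<subseteq> {1..}"
  shows "card (shifts (shift E j) A) = card (shifts E A)"
proof -
  have "shifts (shift E j) A = (+) (j - 1) ` shifts E A"
    by (force simp: mem_shifts shift_def image_iff)
  then show ?thesis
    by (simp add: card_image)
qed

text \<open>A point is lost by punching \<open>R = {2 * n + 1 - f | f \<in> F}\<close> out of \<open>{1..3 * n}\<close> iff all its
  representations \<open>a - 1 + r\<close> with \<open>a \<in> A\<close> and \<open>r \<in> {1..3 * n}\<close> have \<open>r \<in> R\<close>. Since \<open>R\<close> lies in the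
  middle third, one such representation puts the point so far from both ends that every \<open>a \<in> A\<close> provides
  one. All these \<open>r\<close> lie in \<open>R\<close> iff the point is a placement of \<open>A\<close> in \<open>F\<close>. Comparing with the full
  interval cancels the contribution of the ends, which depends on the diameter of \<open>A\<close>.\<close>

lemma card_shifts_interval_split:
  fixes n :: nat and A F :: "nat set"
  assumes A: "A \<subseteq> {1..n}" "A \<noteq> {}" and F: "F \<subseteq> {1..n}"
  shows "finite (placements n A F)"
    and "card (shifts {1..3*n} A) =
         card (shifts ({1..3*n} - (\<lambda>f. 2*n + 1 - f) ` F) A) + card (placements n A F)"
proof -
  let ?R = "(\<lambda>f. 2*n + 1 - f) ` F"
  let ?E = "{1..3*n} - ?R"
  have R: "r \<in> ?R \<longleftrightarrow> (\<exists>f\<in>F. r + f = 2*n + 1)" for r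
    using F by (force simp: image_iff)
  have split: "shifts {1..3*n} A - shifts ?E A = placements n A F"
  proof (intro subset_antisym subsetI)
    fix p assume p: "p \<in> shifts {1..3*n} A - shifts ?E A"
    then obtain a r where a: "a \<in> A" "r \<in> {1..3*n}" "p = a - 1 + r"
      by (auto simp: mem_shifts)
    have outside: "q \<in> ?R" if "b \<in> A" "q \<in> {1..3*n}" "p = b - 1 + q" for b q
      using p that by (metis DiffD2 DiffI mem_shifts)
    have "r \<in> ?R" using outside a .
    then obtain f where f: "f \<in> F" "r + f = 2*n+1" using R by blast
    have pr: "n + 1 \<le> p" "p \<le> 3*n" using f a A F by fastforce+
    show "p \<in> placements n A F"
      unfolding placements_def
    proof (intro CollectI ballI)
      fix b assume b: "b \<in> A"
      then have bn: "1 \<le> b" "b \<le> n" using A by auto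
      define q where "q = p + 1 - b"
      have q: "q \<in> {1..3*n}" "p = b - 1 + q" using pr bn by (auto simp: q_def)
      then have "q \<in> ?R" using outside b by blast
      then obtain g where "g \<in> F" "q + g = 2*n+1" using R by blast
      then show "\<exists>g\<in>F. p + g = b + 2*n" using q bn by (intro bexI[of _ g]) auto
    qed
  next
    fix p assume p: "p \<in> placements n A F"
    have r: "\<exists>r\<in>?R. p + 1 = a + r" if aA: "a \<in> A" for a
    proof -
      obtain f where f: "f \<in> F" "p + f = a + 2*n" using p aA by (auto simp: placements_def)
      then have "1 \<le> f" "f \<le> n" using F by auto
      then show ?thesis using f by (intro bexI[of _ "2*n+1-f"]) auto
    qed
    obtain a where a: "a \<in> A" using A by blast
    obtain r0 where r0: "r0 \<in> ?R" "p + 1 = a + r0" using r[OF a] by blast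
    obtain f where "f \<in> F" "r0 + f = 2*n + 1" using r0 R by blast
    then have "r0 \<in> {1..3*n}" using F by fastforce
    moreover have "p = a - 1 + r0" using r0 a A by auto
    ultimately have "p \<in> shifts {1..3*n} A" unfolding mem_shifts using a by blast
    moreover have "p \<notin> shifts ?E A"
    proof
      assume "p \<in> shifts ?E A"
      then obtain b x where b: "b \<in> A" "x \<in> ?E" "p = b - 1 + x" by (auto simp: mem_shifts)
      obtain r1 where r1: "r1 \<in> ?R" "p + 1 = b + r1" using r[OF b(1)] by blast
      have "1 \<le> b" using b A by auto
      then have "x = r1" using r1 b by simp
      then show False using r1 b by blast
    qed
    ultimately show "p \<in> shifts {1..3*n} A - shifts ?E A" by blast
  qed
  have fin: "finite (shifts {1..3*n} A)"
    using A by (intro finite_shifts) (auto intro: finite_subset)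
  show "finite (placements n A F)"
    unfolding split[symmetric] using fin by blast
  have sub: "shifts ?E A \<subseteq> shifts {1..3*n} A"
    by (rule shifts_mono) blast
  show "card (shifts {1..3*n} A) = card (shifts ?E A) + card (placements n A F)"
    unfolding split[symmetric] using fin sub
    by (metis card_Diff_subset card_mono finite_subset le_add_diff_inverse)
qed

lemma placement_card_le:
  assumes "p \<in> placements n A F" and "finite F"
  shows "card A \<le> card F" and "card A = card F \<Longrightarrow> translates A F"
proof -
  obtain g where g: "\<And>a. a \<in> A \<Longrightarrow> g a \<in> F \<and> p + g a = a + 2 * n"
    using bchoice[of A "\<lambda>a f. f \<in> F \<and> p + f = a + 2 * n"] assms(1)
    by (auto simp: placements_def)
  have inj: "inj_on g A"
    by (metis add_right_cancel g inj_onI)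
  have sub: "g ` A \<subseteq> F" using g by auto
  show "card A \<le> card F"
    using inj sub assms(2) by (rule card_inj_on_le)
  assume "card A = card F"
  then have "g ` A = F"
    using inj sub assms(2) by (metis card_image card_subset_eq)
  moreover have "(+) (2*n) ` A = (+) p ` g ` A"
    using g by (auto simp: image_image add.commute intro!: image_cong)
  ultimately show "translates A F"
    unfolding translates_def by blast
qed

text \<open>Induction on the size of the sets: testing with \<open>F = A k\<close>, sets larger than \<open>F\<close> have no placement
  in \<open>F\<close>, smaller ones are translates of each other by induction, and no other set has the size of \<open>F\<close>.
  So \<open>B k\<close> has as many placements in \<open>A k\<close> as \<open>A k\<close> itself, hence at least one, and this one is onto
  because the sizes agree.\<close>

theorem translates_if_sum_card_shifts_eq:
  fixes A B :: "'i \<Rightarrow> nat set"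
  assumes I: "finite I"
    and A: "\<And>k. k \<in> I \<Longrightarrow> A k \<subseteq> {1..n} \<and> A k \<noteq> {}"
    and B: "\<And>k. k \<in> I \<Longrightarrow> B k \<subseteq> {1..n} \<and> B k \<noteq> {}"
    and card_eq: "\<And>k. k \<in> I \<Longrightarrow> card (A k) = card (B k)"
    and inj: "inj_on (\<lambda>k. card (A k)) I"
    and sums: "\<And>E. finite E \<Longrightarrow> E \<subseteq> {1..} \<Longrightarrow>
                 (\<Sum>k\<in>I. card (shifts E (A k))) = (\<Sum>k\<in>I. card (shifts E (B k)))"
    and k: "k \<in> I"
  shows "translates (A k) (B k)"
  using k
proof (induction "card (A k)" arbitrary: k rule: less_induct)
  case less
  let ?F = "A k"
  let ?E1 = "{1..3*n}"
  let ?E2 = "?E1 - (\<lambda>f. 2*n + 1 - f) ` ?F"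
  have F: "?F \<subseteq> {1..n}" "finite ?F"
    using A[OF less.prems] finite_subset by auto
  have splitA: "(\<Sum>j\<in>I. card (shifts ?E1 (A j))) =
      (\<Sum>j\<in>I. card (shifts ?E2 (A j))) + (\<Sum>j\<in>I. card (placements n (A j) ?F))"
    unfolding sum.distrib[symmetric]
    using A F by (intro sum.cong refl card_shifts_interval_split) auto
  have splitB: "(\<Sum>j\<in>I. card (shifts ?E1 (B j))) =
      (\<Sum>j\<in>I. card (shifts ?E2 (B j))) + (\<Sum>j\<in>I. card (placements n (B j) ?F))"
    unfolding sum.distrib[symmetric]
    using B F by (intro sum.cong refl card_shifts_interval_split) auto
  have total: "(\<Sum>j\<in>I. card (placements n (A j) ?F)) = (\<Sum>j\<in>I. card (placements n (B j) ?F))"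
    using splitA splitB sums[of ?E1] sums[of ?E2] by (auto simp: subset_iff)
  have other: "card (placements n (A j) ?F) = card (placements n (B j) ?F)"
    if j: "j \<in> I - {k}" for j
  proof (cases "card (A j) < card ?F")
    case True
    then have tr: "translates (A j) (B j)" using less.hyps j by blast
    have "card (shifts E (A j)) = card (shifts E (B j))" for E
      using A[of j] B[of j] j by (intro card_shifts_translates tr) auto
    then show ?thesis
      using card_shifts_interval_split(2)[of "A j" n ?F]
        card_shifts_interval_split(2)[of "B j" n ?F] A[of j] B[of j] F j by simp
  next
    case False
    moreover have "card (A j) \<noteq> card ?F"
      using inj j less.prems by (auto dest: inj_onD)
    ultimately have "card ?F < card (A j)" by simp
    then have "placements n (A j) ?F = {}" "placements n (B j) ?F = {}"
      using placement_card_le(1)[OF _ F(2)] card_eq j by (metis DiffD1 equals0I leD)+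
    then show ?thesis by simp
  qed
  have "card (placements n (A k) ?F) = card (placements n (B k) ?F)"
    using total other I less.prems by (simp add: sum.remove[of I k])
  \<comment> \<open>displacement zero\<close>
  moreover have "2 * n \<in> placements n (A k) ?F"
    by (auto simp: placements_def)
  ultimately have "placements n (B k) ?F \<noteq> {}"
    using card_shifts_interval_split(1)[of "A k" n ?F] A[OF less.prems] by auto
  then have "translates (B k) (A k)"
    using placement_card_le(2)[OF _ F(2)] card_eq[OF less.prems] by fastforce
  then show ?case
    unfolding translates_def by metis
qed

section \<open>The least word with prescribed embeddings\<close>

definition superlevel :: "nat list \<Rightarrow> nat \<Rightarrow> nat set" where
  "superlevel u k = {p \<in> {1..length u}. k \<le> letter u p}"

text \<open>At position \<open>p\<close> the least admissible letter is the largest \<open>k\<close> with \<open>p \<in> shifts S (superlevel u k)\<close>,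
  or 1 if there is none. As the sets decrease in \<open>k\<close>, this is the number of such \<open>k \<ge> 2\<close> plus one, a
  form which needs no maximum and can be summed over \<open>p\<close> directly.\<close>

definition minimal_word :: "nat list \<Rightarrow> nat set \<Rightarrow> nat \<Rightarrow> nat list" where
  "minimal_word u S L =
     map (\<lambda>p. 1 + card {k \<in> {2..length u}. p \<in> shifts S (superlevel u k)}) [1..<Suc L]"

lemma length_minimal_word [simp]: "length (minimal_word u S L) = L"
  by (simp add: minimal_word_def)

lemma minimal_word_in_words: "minimal_word u S L \<in> words"
  by (auto simp: minimal_word_def words_def)

lemma superlevel_subset: "superlevel u k \<subseteq> {1..length u}"
  by (auto simp: superlevel_def)

text \<open>Double counting of the pairs of a position and a level \<open>k\<close> reached there. The condition on \<open>S\<close> says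
  that every copy of \<open>u\<close> ends within the first \<open>L\<close> positions, so that none of the shifts is cut off.\<close>

lemma height_minimal_word:
  assumes S: "\<forall>j\<in>S. 1 \<le> j \<and> j + length u - 1 \<le> L"
  shows "height (minimal_word u S L) = L + (\<Sum>k\<in>{2..length u}. card (shifts S (superlevel u k)))"
proof -
  let ?P = "\<lambda>k p. p \<in> shifts S (superlevel u k)"
  have sub: "shifts S (superlevel u k) \<subseteq> {1..L}" for k
    using S by (fastforce simp: mem_shifts superlevel_def)
  have "height (minimal_word u S L) = (\<Sum>p\<in>{1..L}. 1 + card {k \<in> {2..length u}. ?P k p})"
    by (simp add: height_def minimal_word_def interv_sum_list_conv_sum_set_nat
        atLeastLessThanSuc_atLeastAtMost del: upt_Suc)
  also have "\<dots> = L + (\<Sum>p\<in>{1..L}. \<Sum>k\<in>{2..length u}. if ?P k p then 1 else 0)"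
    by (simp add: sum_Suc sum.If_cases Int_def)
  also have "(\<Sum>p\<in>{1..L}. \<Sum>k\<in>{2..length u}. if ?P k p then 1 else 0) =
      (\<Sum>k\<in>{2..length u}. \<Sum>p\<in>{1..L}. if ?P k p then 1 else 0)"
    by (rule sum.swap)
  also have "\<dots> = (\<Sum>k\<in>{2..length u}. card (shifts S (superlevel u k)))"
    using sub by (intro sum.cong refl) (simp add: sum.If_cases Int_absorb1)
  finally show ?thesis .
qed

text \<open>Both sides say that \<open>w\<close> has a letter \<open>\<ge> k\<close> wherever a copy of \<open>u\<close> placed at some \<open>j \<in> S\<close> has one. The
  levels \<open>k \<ge> 2\<close> suffice because all letters of \<open>w\<close> are positive.\<close>

lemma subset_Em_iff_minimal_word:
  assumes u: "set u \<subseteq> {1..length u}"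
    and S: "\<forall>j\<in>S. 1 \<le> j \<and> j + length u - 1 \<le> length w"
    and w: "w \<in> words"
  shows "S \<subseteq> Em u w \<longleftrightarrow> list_all2 (\<le>) (minimal_word u S (length w)) w"
proof -
  let ?n = "length u" and ?L = "length w"
  let ?K = "\<lambda>p. {k \<in> {2..?n}. p \<in> shifts S (superlevel u k)}"
  have pos: "1 \<le> letter w p" if "p \<in> {1..?L}" for p
    using that w by (auto simp: words_def letter_def in_lists_conv_set)
  have level: "1 + card (?K p) \<le> x \<longleftrightarrow> (\<forall>k\<in>?K p. k \<le> x)" if x: "1 \<le> x" for p x
  proof
    assume le: "1 + card (?K p) \<le> x"
    show "\<forall>k\<in>?K p. k \<le> x"
    proof
      fix k assume k: "k \<in> ?K p"
      \<comment> \<open>the superlevel sets decrease with the level\<close>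
      have "{2..k} \<subseteq> ?K p"
        using k by (fastforce simp: mem_shifts superlevel_def)
      then have "card {2..k} \<le> card (?K p)"
        by (intro card_mono) auto
      then show "k \<le> x" using le by simp
    qed
  next
    assume "\<forall>k\<in>?K p. k \<le> x"
    then have "?K p \<subseteq> {2..x}" by auto
    then have "card (?K p) \<le> card {2..x}" by (intro card_mono) auto
    then show "1 + card (?K p) \<le> x" using x by simp
  qed
  have "list_all2 (\<le>) (minimal_word u S ?L) w \<longleftrightarrow>
      (\<forall>q<?L. 1 + card (?K (Suc q)) \<le> letter w (Suc q))"
    by (simp add: list_all2_conv_all_nth minimal_word_def letter_def del: upt_Suc)
  also have "\<dots> \<longleftrightarrow> (\<forall>p\<in>{1..?L}. 1 + card (?K p) \<le> letter w p)"
    unfolding image_Suc_lessThan[symmetric] ball_simps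
    by (simp only: Ball_def lessThan_iff)
  also have "\<dots> \<longleftrightarrow> (\<forall>p\<in>{1..?L}. \<forall>k\<in>?K p. k \<le> letter w p)"
    using level pos by (intro ball_cong refl) blast
  also have "\<dots> \<longleftrightarrow> (\<forall>j\<in>S. \<forall>i\<in>{1..?n}. letter u i \<le> letter w (j + i - 1))"
  proof (intro iffI ballI)
    fix j i assume *: "\<forall>p\<in>{1..?L}. \<forall>k\<in>?K p. k \<le> letter w p" and j: "j \<in> S" and i: "i \<in> {1..?n}"
    have p: "j + i - 1 \<in> {1..?L}" using S j i by fastforce
    have "letter u i \<in> {1..?n}"
      using u i by (auto simp: letter_def subset_iff)
    then consider "letter u i = 1" | "letter u i \<in> {2..?n}" by fastforce
    then show "letter u i \<le> letter w (j + i - 1)"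
    proof cases
      case 1 then show ?thesis using pos[OF p] by simp
    next
      case 2
      have "j + i - 1 \<in> shifts S (superlevel u (letter u i))"
        unfolding mem_shifts using i j
        by (intro bexI[of _ i] bexI[of _ j]) (auto simp: superlevel_def)
      then show ?thesis using * p 2 by blast
    qed
  next
    fix p k assume *: "\<forall>j\<in>S. \<forall>i\<in>{1..?n}. letter u i \<le> letter w (j + i - 1)"
      and k: "k \<in> ?K p"
    then obtain i j where ij: "i \<in> {1..?n}" "k \<le> letter u i" "j \<in> S" "p = i - 1 + j"
      by (auto simp: mem_shifts superlevel_def)
    then have "letter u i \<le> letter w (j + i - 1)" "p = j + i - 1" using * by auto
    then show "k \<le> letter w p" using ij by simp
  qed
  also have "\<dots> \<longleftrightarrow> S \<subseteq> Em u w"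
    using S by (auto simp: Em_def embedding_index_def subset_iff)
  finally show ?thesis by blast
qed

section \<open>Super-strong Wilf equivalence as equality of heights\<close>

lemma sum_list_mono_list_all2:
  "list_all2 (\<le>) m (w :: nat list) \<Longrightarrow> sum_list m \<le> sum_list w"
  by (induction rule: list_all2_induct) auto

lemma super_strongly_Wilf_equivalent_sym:
  assumes "u \<sim>ss v"
  shows "v \<sim>ss u"
proof -
  obtain f where f: "bij_betw f words words" "weight_preserving f"
    "\<forall>w\<in>words. Em u w = Em v (f w)"
    using assms by (auto simp: super_strongly_Wilf_equivalent_def)
  let ?g = "inv_into words f"
  have g: "bij_betw ?g words words" using f(1) by (rule bij_betw_inv_into)
  have gw: "?g w \<in> words" "f (?g w) = w" if "w \<in> words" for w
    using that f(1) g by (auto simp: bij_betw_inv_into_right bij_betwE)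
  show ?thesis
    unfolding super_strongly_Wilf_equivalent_def
    using g gw f(2,3) by (intro exI[of _ ?g]) (metis weight_preserving_def)
qed

text \<open>The bijection sends the least word for \<open>u\<close> to a word of the same height that contains \<open>v\<close> at all
  indices in \<open>S\<close>, and such a word lies above the least word for \<open>v\<close>.\<close>

lemma height_minimal_word_le:
  assumes "u \<sim>ss v" and u: "set u \<subseteq> {1..length u}" and v: "set v \<subseteq> {1..length v}"
    and len: "length u = length v"
    and S: "\<forall>j\<in>S. 1 \<le> j \<and> j + length u - 1 \<le> L"
  shows "height (minimal_word v S L) \<le> height (minimal_word u S L)"
proof -
  let ?m = "minimal_word u S L"
  obtain f where f: "bij_betw f words words" "weight_preserving f"
    "\<forall>w\<in>words. Em u w = Em v (f w)"
    using assms(1) by (auto simp: super_strongly_Wilf_equivalent_def)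
  have m: "?m \<in> words" by (rule minimal_word_in_words)
  then have fm: "f ?m \<in> words" "length (f ?m) = L" "height (f ?m) = height ?m"
    using f by (auto simp: weight_preserving_def bij_betwE)
  have "S \<subseteq> Em u ?m"
    using subset_Em_iff_minimal_word[OF u, of S ?m] S m by (simp add: list_all2_refl)
  then have "S \<subseteq> Em v (f ?m)" using f m by simp
  then have "list_all2 (\<le>) (minimal_word v S L) (f ?m)"
    using subset_Em_iff_minimal_word[OF v, of S "f ?m"] S fm len by simp
  then show ?thesis
    using fm by (metis height_def sum_list_mono_list_all2)
qed

text \<open>Subtracting \<open>m\<close> shows that the number of words of a given height above \<open>m\<close> depends only on
  the length and the sum of \<open>m\<close>.\<close>

lemma bij_betw_dominating_words:
  "bij_betw (\<lambda>x. map2 (+) m x)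
     {x :: nat list. length x = length m \<and> sum_list x + sum_list m = H}
     {w. list_all2 (\<le>) m w \<and> sum_list w = H}"
proof -
  have sum: "sum_list (map2 (+) m x) = sum_list x + sum_list m" if "length x = length m"
    for m x :: "nat list"
    using that by (induction x m rule: list_induct2) auto
  show ?thesis
  proof (rule bij_betw_byWitness[where f' = "\<lambda>w. map2 (-) w m"])
    show "(\<lambda>w. map2 (-) w m) ` {w. list_all2 (\<le>) m w \<and> sum_list w = H}
      \<subseteq> {x. length x = length m \<and> sum_list x + sum_list m = H}"
    proof safe
      fix w assume w: "list_all2 (\<le>) m w" "H = sum_list w"
      then show len: "length (map2 (-) w m) = length m" by (auto simp: list_all2_lengthD)
      have "map2 (+) m (map2 (-) w m) = w"
        using w(1) by (auto simp: list_all2_conv_all_nth intro!: nth_equalityI)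
      then show "sum_list (map2 (-) w m) + sum_list m = sum_list w"
        using sum[OF len] by simp
    qed
  qed (auto simp: sum list_all2_conv_all_nth intro!: nth_equalityI)
qed

lemma finite_words_of_weight: "finite {w \<in> words. length w = L \<and> height w = H}"
proof (rule finite_subset)
  show "{w \<in> words. length w = L \<and> height w = H} \<subseteq> {w. set w \<subseteq> {..H} \<and> length w = L}"
    by (auto simp: height_def member_le_sum_list)
qed (auto intro: finite_lists_length_eq)

text \<open>Moebius inversion on the subsets of \<open>J\<close>, as an induction that passes from larger to smaller sets.\<close>

lemma card_fibre_eq_if_card_superset_eq:
  fixes g h :: "'a \<Rightarrow> 'b set"
  assumes W: "finite W" and J: "finite J"
    and gJ: "\<And>w. w \<in> W \<Longrightarrow> g w \<subseteq> J" and hJ: "\<And>w. w \<in> W \<Longrightarrow> h w \<subseteq> J"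
    and eq: "\<And>S. S \<subseteq> J \<Longrightarrow> card {w \<in> W. S \<subseteq> g w} = card {w \<in> W. S \<subseteq> h w}"
    and S: "S \<subseteq> J"
  shows "card {w \<in> W. g w = S} = card {w \<in> W. h w = S}"
  using S
proof (induction "card (J - S)" arbitrary: S rule: less_induct)
  case less
  let ?Q = "{S'. S' \<subseteq> J \<and> S \<subset> S'}"
  have finQ: "finite ?Q" using J by (auto intro: finite_subset[of _ "Pow J"])
  have split: "card {w \<in> W. S \<subseteq> k w} = card {w \<in> W. k w = S} + (\<Sum>S'\<in>?Q. card {w \<in> W. k w = S'})"
    if kJ: "\<And>w. w \<in> W \<Longrightarrow> k w \<subseteq> J" for k :: "'a \<Rightarrow> 'b set"
  proof -
    have "{w \<in> W. S \<subseteq> k w} = {w \<in> W. k w = S} \<union> (\<Union>S'\<in>?Q. {w \<in> W. k w = S'})"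
      using kJ by auto
    then have "card {w \<in> W. S \<subseteq> k w} =
        card {w \<in> W. k w = S} + card (\<Union>S'\<in>?Q. {w \<in> W. k w = S'})"
      using W finQ by (simp only:) (rule card_Un_disjoint; auto)
    also have "card (\<Union>S'\<in>?Q. {w \<in> W. k w = S'}) = (\<Sum>S'\<in>?Q. card {w \<in> W. k w = S'})"
      using W finQ by (intro card_UN_disjoint) auto
    finally show ?thesis .
  qed
  have "(\<Sum>S'\<in>?Q. card {w \<in> W. g w = S'}) = (\<Sum>S'\<in>?Q. card {w \<in> W. h w = S'})"
  proof (intro sum.cong refl)
    fix S' assume S': "S' \<in> ?Q"
    then have "J - S' \<subset> J - S" using less.prems by auto
    then have "card (J - S') < card (J - S)" using J by (intro psubset_card_mono) auto
    then show "card {w \<in> W. g w = S'} = card {w \<in> W. h w = S'}"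
      using less.hyps S' by blast
  qed
  then show ?case
    using split[of g] split[of h] gJ hJ eq[OF less.prems] by simp
qed

lemma bij_betw_if_card_fibre_eq:
  assumes fin: "\<And>c. finite {w \<in> W. g w = c}" "\<And>c. finite {w \<in> W. h w = c}"
    and eq: "\<And>c. card {w \<in> W. g w = c} = card {w \<in> W. h w = c}"
  obtains f where "bij_betw f W W" and "\<And>w. w \<in> W \<Longrightarrow> h (f w) = g w"
proof -
  have "\<forall>c. \<exists>f. bij_betw f {w \<in> W. g w = c} {w \<in> W. h w = c}"
    using fin eq by (blast intro: finite_same_card_bij)
  then obtain \<phi> where \<phi>: "\<And>c. bij_betw (\<phi> c) {w \<in> W. g w = c} {w \<in> W. h w = c}"
    by metis
  define f where "f w = \<phi> (g w) w" for w
  have f: "f w \<in> W" "h (f w) = g w" if "w \<in> W" for w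
    using bij_betwE[OF \<phi>[of "g w"]] that by (auto simp: f_def)
  have "inj_on f W"
  proof (rule inj_onI)
    fix x y assume xy: "x \<in> W" "y \<in> W" "f x = f y"
    then have "g x = g y" using f by metis
    then show "x = y"
      using xy bij_betw_imp_inj_on[OF \<phi>[of "g x"]] by (auto simp: f_def inj_on_def)
  qed
  moreover have "W \<subseteq> f ` W"
  proof
    fix y assume y: "y \<in> W"
    then have "y \<in> \<phi> (h y) ` {w \<in> W. g w = h y}"
      using bij_betw_imp_surj_on[OF \<phi>[of "h y"]] by auto
    then obtain x where "x \<in> W" "g x = h y" "y = \<phi> (h y) x" by blast
    then show "y \<in> f ` W" by (metis f_def imageI)
  qed
  ultimately have "bij_betw f W W"
    using f by (auto simp: bij_betw_def)
  then show thesis using that f by blast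
qed

text \<open>If the heights agree, then for every length, height and \<open>S\<close> equally many words have their \<open>u\<close>-indices
  and their \<open>v\<close>-indices include \<open>S\<close>. Inverting over \<open>S\<close>, each triple of length, height and exact
  index set is attained equally often, by finitely many words, and matching these classes gives
  the bijection.\<close>

theorem super_strongly_Wilf_equivalent_iff_height_minimal_word:
  assumes u: "set u \<subseteq> {1..length u}" and v: "set v \<subseteq> {1..length v}"
    and len: "length u = length v"
  shows "u \<sim>ss v \<longleftrightarrow>
    (\<forall>L S. (\<forall>j\<in>S. 1 \<le> j \<and> j + length u - 1 \<le> L) \<longrightarrow>
       height (minimal_word u S L) = height (minimal_word v S L))"
    (is "_ \<longleftrightarrow> ?heights")
proof
  assume uv: "u \<sim>ss v"
  then show ?heights
    using height_minimal_word_le[OF uv u v len]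
      height_minimal_word_le[OF super_strongly_Wilf_equivalent_sym[OF uv] v u] len
    by (metis le_antisym)
next
  assume heights: ?heights
  have card_supersets: "card {w \<in> words. length w = L \<and> height w = H \<and> S \<subseteq> Em u w} =
      card {w \<in> words. length w = L \<and> height w = H \<and> S \<subseteq> Em v w}" for L H S
  proof (cases "\<forall>j\<in>S. 1 \<le> j \<and> j + length u - 1 \<le> L")
    case True
    have dominating: "card {w \<in> words. length w = L \<and> height w = H \<and> S \<subseteq> Em x w} =
        card {y :: nat list. length y = L \<and> sum_list y + height (minimal_word x S L) = H}"
      if x: "set x \<subseteq> {1..length x}" and lenx: "length x = length u" for x
    proof -
      let ?m = "minimal_word x S L"
      have in_words: "w \<in> words" if "list_all2 (\<le>) ?m w" for w
      proof -
        have "1 \<le> w ! i" if "i < length w" for i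
        proof -
          have "?m ! i \<le> w ! i" and "i < length ?m"
            using \<open>list_all2 (\<le>) ?m w\<close> that by (auto simp: list_all2_conv_all_nth)
          moreover have "1 \<le> ?m ! i"
            using minimal_word_in_words[of x S L] \<open>i < length ?m\<close>
            by (auto simp: words_def in_lists_conv_set)
          ultimately show ?thesis by linarith
        qed
        then show ?thesis by (auto simp: words_def in_set_conv_nth)
      qed
      have "S \<subseteq> Em x w \<longleftrightarrow> list_all2 (\<le>) ?m w" if "w \<in> words" "length w = L" for w
        using subset_Em_iff_minimal_word[OF x, of S w] True lenx that by simp
      moreover have "length w = L" if "list_all2 (\<le>) ?m w" for w
        using list_all2_lengthD[OF that] by simp
      ultimately have "{w \<in> words. length w = L \<and> height w = H \<and> S \<subseteq> Em x w} =
          {w. list_all2 (\<le>) ?m w \<and> sum_list w = H}"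
        using in_words unfolding height_def by blast
      then show ?thesis
        using bij_betw_same_card[OF bij_betw_dominating_words[of ?m H]]
        by (simp add: height_def)
    qed
    show ?thesis
      using dominating[OF u] dominating[OF v] len heights True by simp
  next
    case False
    \<comment> \<open>some index in \<open>S\<close> is zero or leaves no room for a copy of \<open>u\<close>\<close>
    then have empty: "{w \<in> words. length w = L \<and> height w = H \<and> S \<subseteq> Em x w} = {}"
      if "length x = length u" for x
      using that by (auto simp: Em_def embedding_index_def)
    show ?thesis
      unfolding empty[OF refl] empty[OF len[symmetric]] by (rule refl)
  qed
  let ?key = "\<lambda>x w. ((length w, height w), Em x w)"
  have fibre: "{w \<in> words. ?key x w = ((L, H), S)} =
      {w \<in> {w \<in> words. length w = L \<and> height w = H}. Em x w = S}" for x L H S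
    by auto
  have "finite {w \<in> words. ?key x w = c}" for x c
    by (cases c; cases "fst c") (auto simp: finite_words_of_weight
        intro: finite_subset[OF _ finite_words_of_weight])
  moreover have "card {w \<in> words. ?key u w = c} = card {w \<in> words. ?key v w = c}" for c
  proof -
    obtain L H S where c: "c = ((L, H), S)" by (metis surj_pair)
    have Em_bound: "Em x w \<subseteq> {1..Suc L}" if "length w = L" for x w
      using that by (auto simp: Em_def embedding_index_def)
    show ?thesis
    proof (cases "S \<subseteq> {1..Suc L}")
      case True
      show ?thesis
        unfolding c fibre
        using finite_words_of_weight Em_bound card_supersets True
        by (intro card_fibre_eq_if_card_superset_eq[where J = "{1..Suc L}"]) auto
    next
      case False
      then have empty: "{w \<in> words. ?key x w = c} = {}" for x
        using Em_bound by (auto simp: c)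
      show ?thesis unfolding empty by (rule refl)
    qed
  qed
  ultimately obtain f where "bij_betw f words words"
      and "\<And>w. w \<in> words \<Longrightarrow> ?key v (f w) = ?key u w"
    using bij_betw_if_card_fibre_eq[of words "?key u" "?key v"] by metis
  then show "u \<sim>ss v"
    unfolding super_strongly_Wilf_equivalent_def weight_preserving_def
    by (intro exI[of _ f]) auto
qed

section \<open>Superlevel sets and overlaps of a permutation\<close>

lemma letter_inverse_word:
  assumes u: "u \<in> permutations_of_set {1..n}" and p: "p \<in> {1..n}"
  shows "letter (inverse_word u) (letter u p) = p"
proof -
  have len: "length u = n" and set: "set u = {1..n}" and dist: "distinct u"
    using u by (auto simp: permutations_of_set_def distinct_card[symmetric])
  have up: "letter u p \<in> {1..n}"
    using p len nth_mem[of "p - 1" u] by (auto simp: letter_def set)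
  have "position u (letter u p) = p"
    unfolding position_def
  proof (rule the_equality)
    fix q assume "q \<in> {1..length u} \<and> letter u q = letter u p"
    then have "q - 1 = p - 1" "1 \<le> q"
      using dist p len nth_eq_iff_index_eq[of u "q - 1" "p - 1"] by (auto simp: letter_def)
    then show "q = p" using p by auto
  qed (use p len in auto)
  then show ?thesis
    using up len by (auto simp: inverse_word_def letter_def simp del: upt_Suc)
qed

lemma bij_betw_letter:
  assumes u: "u \<in> permutations_of_set {1..n}"
  shows "bij_betw (letter u) {1..n} {1..n}"
proof -
  have len: "length u = n" and set: "set u = {1..n}"
    using u by (auto simp: permutations_of_set_def distinct_card[symmetric])
  have "inj_on (letter u) {1..n}"
    using letter_inverse_word[OF u] by (rule inj_on_inverseI)
  moreover have "letter u ` {1..n} \<subseteq> {1..n}"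
  proof (rule image_subsetI)
    fix p assume "p \<in> {1..n}"
    then have "letter u p \<in> set u" using len by (auto simp: letter_def)
    then show "letter u p \<in> {1..n}" using set by simp
  qed
  ultimately show ?thesis
    by (simp add: bij_betw_def endo_inj_surj)
qed

lemma letter_image_superlevel:
  assumes u: "u \<in> permutations_of_set {1..n}" and k: "1 \<le> k"
  shows "letter u ` superlevel u k = {k..n}"
proof -
  have len: "length u = n"
    using u by (auto simp: permutations_of_set_def distinct_card[symmetric])
  have "letter u ` superlevel u k = {y \<in> letter u ` {1..n}. k \<le> y}"
    unfolding superlevel_def len by blast
  also have "\<dots> = {y \<in> {1..n}. k \<le> y}"
    unfolding bij_betw_imp_surj_on[OF bij_betw_letter[OF u]] by (rule refl)
  also have "\<dots> = {k..n}"
    using k by auto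
  finally show ?thesis .
qed

lemma inverse_word_image:
  assumes u: "u \<in> permutations_of_set {1..n}" and k: "1 \<le> k"
  shows "letter (inverse_word u) ` {k..n} = superlevel u k"
proof -
  have "letter (inverse_word u) ` {k..n} =
      (\<lambda>p. letter (inverse_word u) (letter u p)) ` superlevel u k"
    unfolding letter_image_superlevel[OF assms, symmetric] image_image by (rule refl)
  also have "\<dots> = (\<lambda>p. p) ` superlevel u k"
    using superlevel_subset[of u k] length_finite_permutations_of_set[OF u]
    by (intro image_cong refl letter_inverse_word[OF u]) auto
  finally show ?thesis by simp
qed

lemma card_superlevel:
  assumes u: "u \<in> permutations_of_set {1..n}" and k: "1 \<le> k"
  shows "card (superlevel u k) = Suc n - k"
proof -
  have "superlevel u k \<subseteq> {1..n}"
    using superlevel_subset[of u k] length_finite_permutations_of_set[OF u] by simp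
  then have "inj_on (letter u) (superlevel u k)"
    using bij_betw_imp_inj_on[OF bij_betw_letter[OF u]] inj_on_subset by blast
  then show ?thesis
    using card_image letter_image_superlevel[OF assms] by (metis card_atLeastAtMost)
qed

lemma Union_shift_inverse_word:
  assumes "u \<in> permutations_of_set {1..n}" and "1 \<le> k"
  shows "(\<Union>j\<in>{k..n}. shift E (letter (inverse_word u) j)) = shifts E (superlevel u k)"
  unfolding inverse_word_image[OF assms, symmetric] shifts_def by simp

text \<open>Passing from level \<open>i + 1\<close> to level \<open>i\<close> adds the single position of the letter \<open>i\<close>, hence one shift
  of \<open>E\<close>, whose intersection with the earlier ones is the overlap in question.\<close>

lemma card_shifts_superlevel_Suc:
  assumes u: "u \<in> permutations_of_set {1..n}" and E: "finite E" and i: "i \<in> {1..n}"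
  shows "card (shifts E (superlevel u i)) +
      card (shift E (letter (inverse_word u) i) \<inter>
        (\<Union>j\<in>{i + 1..n}. shift E (letter (inverse_word u) j))) =
    card E + card (shifts E (superlevel u (Suc i)))"
proof -
  let ?s = "letter (inverse_word u)"
  have "{i..n} = insert i {i + 1..n}" using i by auto
  then have "shifts E (superlevel u i) = shift E (?s i) \<union> (\<Union>j\<in>{i + 1..n}. shift E (?s j))"
    using i by (simp add: Union_shift_inverse_word[OF u, symmetric])
  moreover have "(\<Union>j\<in>{i + 1..n}. shift E (?s j)) = shifts E (superlevel u (Suc i))"
    using Union_shift_inverse_word[OF u, of "i + 1"] by simp
  ultimately show ?thesis
    using card_Un_Int[of "shift E (?s i)" "\<Union>j\<in>{i + 1..n}. shift E (?s j)"] E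
      finite_shifts[OF E, of "superlevel u (Suc i)"]
      finite_subset[OF superlevel_subset finite_atLeastAtMost] by simp
qed

section \<open>Embedding sets\<close>

lemma finite_embedding_set: "embedding_set E \<Longrightarrow> finite E"
  by (auto simp: embedding_set_def)

lemma embedding_setI:
  assumes fin: "finite E" and "1 \<in> E" and "0 \<notin> E"
  shows "embedding_set E"
proof -
  define xs where "xs = sorted_list_of_set E"
  have xs: "set xs = E" using fin by (simp add: xs_def)
  have ne: "xs \<noteq> []" using xs assms by auto
  have strict: "xs ! i < xs ! j" if "i < j" "j < length xs" for i j
    using that unfolding xs_def by (rule sorted_wrt_nth_less[OF strict_sorted_list_of_set])
  obtain i where i: "i < length xs" "xs ! i = 1"
    using xs assms(2) by (metis in_set_conv_nth)
  have "xs ! 0 \<in> E" using ne xs nth_mem[of 0 xs] by simp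
  then have "xs ! 0 \<noteq> 0" using assms(3) by metis
  moreover have "xs ! 0 \<le> 1" using strict[of 0 i] i by (cases "i = 0") auto
  ultimately have first: "xs ! 0 = 1" by linarith
  define e where "e k = xs ! k - xs ! (k - 1)" for k
  have partial: "1 + (\<Sum>k=1..m. e k) = xs ! m" if "m < length xs" for m
    using that
  proof (induction m)
    case 0 then show ?case by (simp add: first)
  next
    case (Suc m)
    then show ?case using strict[of m "Suc m"] by (simp add: e_def)
  qed
  have index: "m \<le> length xs - 1 \<longleftrightarrow> m < length xs" for m
    using ne by (cases xs) auto
  have "E = {xs ! m |m. m < length xs}"
    using set_conv_nth[of xs] xs by simp
  also have "\<dots> = {1 + (\<Sum>k=1..m. e k) |m. m \<le> length xs - 1}"
    unfolding index by (intro Collect_cong ex_cong1) (metis partial)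
  finally have "E = {1 + (\<Sum>k=1..m. e k) |m. m \<le> length xs - 1}" .
  moreover have "\<forall>k\<in>{1..length xs - 1}. 0 < e k"
    using strict by (auto simp: e_def)
  ultimately show ?thesis
    unfolding embedding_set_def by blast
qed

text \<open>The least embedding index is normalised to 1 in an embedding set; up to a shift, this
  restricts an index set only to be finite and nonempty.\<close>

lemma shift_of_embedding_set:
  assumes "finite S" and "S \<noteq> {}" and "0 \<notin> S"
  obtains E where "embedding_set E" and "S = shift E (Min S)"
proof
  let ?E = "(\<lambda>x. x - (Min S - 1)) ` S"
  have min: "1 \<le> Min S" "Min S \<in> S" "\<And>x. x \<in> S \<Longrightarrow> Min S \<le> x"
    using assms by (auto simp: Suc_le_eq intro: gr0I)
  show "embedding_set ?E"
  proof (rule embedding_setI)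
    show "1 \<in> ?E" using min by (auto intro!: rev_image_eqI[of "Min S"])
    show "0 \<notin> ?E" using min by fastforce
  qed (use assms in auto)
  show "S = shift ?E (Min S)"
    using min by (force simp: shift_def image_image)
qed

section \<open>The overlap criterion\<close>

theorem proposition2:
  fixes n :: nat and u v s t :: "nat list"
  assumes "u \<in> permutations_of_set {1..n}" and "v \<in> permutations_of_set {1..n}"
    and "s = inverse_word u" and "t = inverse_word v"
  shows "u \<sim>ss v \<longleftrightarrow>
    (\<forall>i\<in>{1..n - 1}. \<forall>E. embedding_set E \<longrightarrow>
       card (shift E (letter s i) \<inter> (\<Union>j\<in>{i + 1..n}. shift E (letter s j))) =
       card (shift E (letter t i) \<inter> (\<Union>j\<in>{i + 1..n}. shift E (letter t j))))"
proof -
  note u = assms(1) and v = assms(2)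
  have len: "length u = n" "length v = n" and set: "set u \<subseteq> {1..length u}" "set v \<subseteq> {1..length v}"
    using u v by (auto simp: permutations_of_set_def distinct_card[symmetric])
  let ?U = "\<lambda>x k E. card (shifts E (superlevel x k))"
  have pos: "superlevel x k \<subseteq> {1..}" for x k
    by (auto simp: superlevel_def)
  have equiv: "u \<sim>ss v \<longleftrightarrow>
      (\<forall>E. finite E \<longrightarrow> E \<subseteq> {1..} \<longrightarrow> (\<Sum>k\<in>{2..n}. ?U u k E) = (\<Sum>k\<in>{2..n}. ?U v k E))"
    unfolding super_strongly_Wilf_equivalent_iff_height_minimal_word[OF set, unfolded len, OF refl]
  proof (intro iffI allI impI)
    fix E :: "nat set"
    assume heights: "\<forall>L S. (\<forall>j\<in>S. 1 \<le> j \<and> j + n - 1 \<le> L) \<longrightarrow>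
        height (minimal_word u S L) = height (minimal_word v S L)"
      and E: "finite E" "E \<subseteq> {1..}"
    have "1 \<le> j \<and> j + n - 1 \<le> Max E + n" if "j \<in> E" for j
      using Max_ge[OF E(1) that] E(2) that by auto
    then show "(\<Sum>k\<in>{2..n}. ?U u k E) = (\<Sum>k\<in>{2..n}. ?U v k E)"
      using heights height_minimal_word[of E u "Max E + n"] height_minimal_word[of E v "Max E + n"]
      by (simp add: len)
  next
    fix L S
    assume sums: "\<forall>E. finite E \<longrightarrow> E \<subseteq> {1..} \<longrightarrow>
        (\<Sum>k\<in>{2..n}. ?U u k E) = (\<Sum>k\<in>{2..n}. ?U v k E)"
      and S: "\<forall>j\<in>S. 1 \<le> j \<and> j + n - 1 \<le> L"
    have "S \<subseteq> {1..Suc L}" using S by fastforce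
    then have "finite S" "S \<subseteq> {1..}" using finite_subset by auto
    then show "height (minimal_word u S L) = height (minimal_word v S L)"
      using sums height_minimal_word[of S u L] height_minimal_word[of S v L] S by (simp add: len)
  qed
  show ?thesis
    unfolding assms(3,4)
  proof (intro iffI ballI allI impI)
    fix i E assume uv: "u \<sim>ss v" and i: "i \<in> {1..n - 1}" and E: "embedding_set E"
    have fin: "finite E" using E by (rule finite_embedding_set)
    have inj: "inj_on (\<lambda>k. card (superlevel u k)) {2..n}"
      using card_superlevel[OF u] by (auto simp: inj_on_def)
    have "translates (superlevel u k) (superlevel v k)" if "k \<in> {2..n}" for k
    proof (rule translates_if_sum_card_shifts_eq[where n = n and I = "{2..n}"])
      fix k assume "k \<in> {2..n}"
      then have "card (superlevel u k) = Suc n - k" "card (superlevel v k) = Suc n - k"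
        and "Suc n - k > 0"
        using card_superlevel[OF u] card_superlevel[OF v] by auto
      then show "card (superlevel u k) = card (superlevel v k)"
        and "superlevel u k \<subseteq> {1..n} \<and> superlevel u k \<noteq> {}"
        and "superlevel v k \<subseteq> {1..n} \<and> superlevel v k \<noteq> {}"
        using superlevel_subset len by (metis, metis card.empty less_irrefl,
            metis card.empty less_irrefl)
    qed (use inj equiv uv that in auto)
    then have "?U u k E = ?U v k E" if "k \<in> {2..n}" for k
      using that pos by (intro card_shifts_translates) auto
    moreover have "superlevel u 1 = {1..n}" "superlevel v 1 = {1..n}"
      using bij_betwE[OF bij_betw_letter[OF u]] bij_betwE[OF bij_betw_letter[OF v]] len
      by (auto simp: superlevel_def)
    \<comment> \<open>the first level is missing from the sums, but there both sets consist of all positions\<close>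
    ultimately have U: "?U u k E = ?U v k E" if "k \<in> {1..n}" for k
      using that by (cases "k = 1") auto
    have "?U u i E = ?U v i E" "?U u (Suc i) E = ?U v (Suc i) E"
      using i by (auto intro!: U)
    then show "card (shift E (letter (inverse_word u) i) \<inter>
          (\<Union>j\<in>{i + 1..n}. shift E (letter (inverse_word u) j))) =
        card (shift E (letter (inverse_word v) i) \<inter>
          (\<Union>j\<in>{i + 1..n}. shift E (letter (inverse_word v) j)))"
      using card_shifts_superlevel_Suc[OF u fin, of i] card_shifts_superlevel_Suc[OF v fin, of i] i
      by force
  next
    assume overlaps: "\<forall>i\<in>{1..n - 1}. \<forall>E. embedding_set E \<longrightarrow>
       card (shift E (letter (inverse_word u) i) \<inter>
          (\<Union>j\<in>{i + 1..n}. shift E (letter (inverse_word u) j))) =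
       card (shift E (letter (inverse_word v) i) \<inter>
          (\<Union>j\<in>{i + 1..n}. shift E (letter (inverse_word v) j)))"
    have U: "?U u k E = ?U v k E" if E: "embedding_set E" and k: "1 \<le> k" "k \<le> Suc n" for k E
      using k(2,1)
    proof (induction k rule: inc_induct)
      case base
      have "superlevel u (Suc n) = {}" "superlevel v (Suc n) = {}"
        using inverse_word_image[OF u, of "Suc n"] inverse_word_image[OF v, of "Suc n"] by auto
      then show ?case by simp
    next
      case (step k)
      have fin: "finite E" using E by (rule finite_embedding_set)
      have "card (shift E (letter (inverse_word u) k) \<inter>
          (\<Union>j\<in>{k + 1..n}. shift E (letter (inverse_word u) j))) =
        card (shift E (letter (inverse_word v) k) \<inter>
          (\<Union>j\<in>{k + 1..n}. shift E (letter (inverse_word v) j)))"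
      \<comment> \<open>for the largest letter the union is empty and both overlaps vanish\<close>
      proof (cases "k = n")
        case False
        then have "k \<in> {1..n - 1}" using step.hyps step.prems by auto
        then show ?thesis using overlaps E by blast
      qed simp
      then show ?case
        using card_shifts_superlevel_Suc[OF u fin, of k] card_shifts_superlevel_Suc[OF v fin, of k]
          step by force
    qed
    show "u \<sim>ss v"
      unfolding equiv
    proof (intro allI impI sum.cong refl)
      fix S :: "nat set" and k assume S: "finite S" "S \<subseteq> {1..}" and k: "k \<in> {2..n}"
      show "?U u k S = ?U v k S"
      proof (cases "S = {}")
        case True
        then show ?thesis by (simp add: shifts_def shift_def)
      next
        case False
        then obtain E where E: "embedding_set E" "S = shift E (Min S)"
          using shift_of_embedding_set[of S] S by (metis atLeast_iff not_one_le_zero subsetD)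
        have "?U x k S = ?U x k E" for x
          using card_shifts_shift[OF pos] E(2) by metis
        then show ?thesis using U[OF E(1), of k] k by simp
      qed
    qed
  qed
qed

end
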